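(* The fermionic projector $P=\breve b^<\,\hat t\,\hat Y\,\hat t\;\breve b^>$ defined in the context is idempotent, $$P^2=P,$$ in the sense of formal power series in the external potential and of the fixed-mass convention, i.e. $P_mP_{m'}=\delta(m-m')\,P_m$ for $m,m'>0$.
   Context: Free operators. Minkowski space is $\mathbb R^4$ with inner product of signature $(+,-,-,-)$, $\gamma^\mu$ are the Dirac matrices, $\epsilon(\cdot)$ is the sign function. Operators act on 4-spinor-valued functions via integral kernels, $(TS)(x,y)=\int T(x,z)S(z,y)\,d^4z$. For $m>0$, $p_m(x,y)=\int\frac{d^4q}{(2\pi)^4}(q_\mu\gamma^\mu+m)\,\delta(q^2-m^2)\,e^{-iq(x-y)}$, $k_m(x,y)=\int\frac{d^4q}{(2\pi)^4}(q_\mu\gamma^\mu+m)\,\delta(q^2-m^2)\,\epsilon(q_0)\,e^{-iq(x-y)}$, $s^\vee_m(x,y)=\lim_{\varepsilon\searrow0}\int\frac{d^4q}{(2\pi)^4}\frac{q_\mu\gamma^\mu+m}{q^2-m^2-i\varepsilon q_0}e^{-iq(x-y)}$, $s^\wedge_m$ is the same with $+i\varepsilon q_0$, and $s_m=\frac12(s_m^\vee+s_m^\wedge)$. Potential. $\mathscr B$ is a matrix-valued external potential on $\mathbb R^4$ (a multiplication operator), smooth and such that $\mathscr B(x)$, $x_i\mathscr B(x)$, $x_ix_j\mathscr B(x)$ are integrable; then every product $C_n\mathscr B C_{n-1}\mathscr B\cdots\mathscr B C_0$ with $C_i\in\{k_m,p_m,s_m\}$ is a well-defined tempered distribution. All expansions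 are formal power series in $\mathscr B$. Set $b_m^<=\sum_{n\ge0}(-s_m\mathscr B)^n$, $b_m=\sum_{n\ge0}(-\mathscr Bs_m)^n\mathscr B$, $b_m^>=\sum_{n\ge0}(-\mathscr Bs_m)^n$. Fixed-mass convention. For $C,C'\in\{p,k\}$ one has $p_mp_{m'}=k_mk_{m'}=\delta(m-m')p_m$, $p_mk_{m'}=k_mp_{m'}=\delta(m-m')k_m$ and $C_m b_m^>b_{m'}^<C'_{m'}=\delta(m-m')\,\big(C(p+\pi^2pbpbp)C'\big)_m$. The factors $\delta(m-m')$ and the subscripts $m$ are omitted, so that products of expressions $C_1bC_2b\cdots bC_n$ ($C_i\in\{p,k\}$) and of such expressions enclosed between $b^<$ and $b^>$ are computed with the rules $p^2=k^2=p$, $pk=kp=k$, $b^>b^<=p+\pi^2pbpbp$ (between factors $p$ or $k$). The operator $p$ acts as identity, and powers of $p+\pi^2pbpbp$ are defined by binomial series. Construction of $P$. Put $p+A=(p+\pi^2pbpbp)^{1/2}$, $\breve b^<=b^<(p+\pi^2pbpbp)^{-1/2}$, $\breve b^>=(p+\pi^2pbpbp)^{-1/2}b^>$ (so $\breve b^>\breve b^<=p$), and $\hat k=\sum_{\beta\ge0}(-i\pi)^{2\beta}(p+A)k(bk)^{2\beta}(p+A)$, $X=-p+\sum_{\beta_1,\beta_2\ge0}(-i\pi)^{2(\beta_1+\beta_2)}(p+A)k(bk)^{2\beta_1}(p+A)^2k(bk)^{2\beta_2}(p+A)$ (which is of order at least two in $\mathscr B$), $\hat p=(p+X)^{1/2}=p+\sum_{n\ge1}(-1)^{n+1}\frac{(2n-3)!!}{n!\,2^n}X^n$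 (with $(-1)!!=1$), $\hat t=\frac12(\hat p-\hat k)$, $\hat Y=p+\sum_{l\ge1}(-1)^lX^l$. The operators $\tilde k=\breve b^<\hat k\,\breve b^>$, $\tilde p=\breve b^<\hat p\,\breve b^>$, $\tilde t=\frac12(\tilde p-\tilde k)$, $Y=\breve b^<\hat Y\breve b^>$ are the interacting operators, and the fermionic projector is $P=\tilde tY\tilde t=\breve b^<\,\hat t\,\hat Y\,\hat t\,\breve b^>$. *)

theory Defs
  imports "HOL-Analysis.Analysis"
begin

section \<open>The fixed-mass calculus\<close>

text \<open>
  Words \<open>C\<^sub>1 b C\<^sub>2 b \<dots> b C\<^sub>n\<close> with \<open>C\<^sub>i\<close> one of \<open>p\<close>, \<open>k\<close>: \<open>Op C\<close> is the one-letter word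
  \<open>C\<close>, and \<open>OpB C w\<close> is the word \<open>C b w\<close>.  In a product the two letters that meet are merged
  by the rules \<open>p\<^sup>2 = k\<^sup>2 = p\<close>, \<open>pk = kp = k\<close>.
\<close>

datatype pk = Pm | Km

definition pk_mult :: "pk \<Rightarrow> pk \<Rightarrow> pk" where
  "pk_mult C D = (if C = D then Pm else Km)"

datatype bword = Op pk | OpB pk bword

fun num_b :: "bword \<Rightarrow> nat" where
  "num_b (Op C) = 0"
| "num_b (OpB C w) = Suc (num_b w)"

fun bword_mult :: "bword \<Rightarrow> bword \<Rightarrow> bword" where
  "bword_mult (Op C) (Op D) = Op (pk_mult C D)"
| "bword_mult (Op C) (OpB D w) = OpB (pk_mult C D) w"
| "bword_mult (OpB C v) w = OpB C (bword_mult v w)"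

lemma num_b_mult: "num_b (bword_mult v w) = num_b v + num_b w"
  by (induction v w rule: bword_mult.induct) auto

lemma pk_mult_assoc: "pk_mult (pk_mult a c) d = pk_mult a (pk_mult c d)"
  by (cases a; cases c; cases d) (auto simp: pk_mult_def)

lemma bword_mult_assoc: "bword_mult (bword_mult u v) w = bword_mult u (bword_mult v w)"
proof (induction u)
  case (Op C)
  show ?case by (cases v; cases w) (auto simp: pk_mult_assoc)
qed auto

lemma pk_mult_Pm [simp]: "pk_mult Pm C = C" "pk_mult C Pm = C"
  by (cases C; simp add: pk_mult_def)+

lemma bword_mult_Pm [simp]: "bword_mult (Op Pm) w = w" "bword_mult w (Op Pm) = w"
proof -
  show "bword_mult (Op Pm) w = w" by (cases w) auto
  show "bword_mult w (Op Pm) = w" by (induction w) auto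
qed

lemma finite_num_b: "finite {w. num_b w \<le> n}"
proof (induction n)
  case 0
  have "w \<in> {Op Pm, Op Km}" if "num_b w \<le> 0" for w
  proof (cases w)
    case (Op C)
    then show ?thesis by (cases C) auto
  qed (use that in simp)
  then have "{w. num_b w \<le> 0} \<subseteq> {Op Pm, Op Km}"
    by blast
  then show ?case using finite_subset by blast
next
  case (Suc n)
  have "w \<in> {Op Pm, Op Km} \<union> (OpB Pm ` {w. num_b w \<le> n} \<union> OpB Km ` {w. num_b w \<le> n})"
    if "num_b w \<le> Suc n" for w
  proof (cases w)
    case (Op C)
    then show ?thesis by (cases C) auto
  next
    case (OpB C v)
    then show ?thesis using that by (cases C) auto
  qed
  then have "{w. num_b w \<le> Suc n} \<subseteq> {Op Pm, Op Km} \<union>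
      (OpB Pm ` {w. num_b w \<le> n} \<union> OpB Km ` {w. num_b w \<le> n})"
    by blast
  then show ?case using Suc finite_subset by blast
qed

lemma finite_factorizations: "finite {(u, v). bword_mult u v = w}"
proof (rule finite_subset)
  show "{(u, v). bword_mult u v = w} \<subseteq> {u. num_b u \<le> num_b w} \<times> {u. num_b u \<le> num_b w}"
    by (auto simp: num_b_mult)
qed (simp add: finite_num_b)

text \<open>
  Formal power series: arbitrary complex linear combinations of words.  As \<open>b\<close> is of order one in
  the potential, only finitely many words contribute to each order.
\<close>

datatype fm = Series (coeff: "bword \<Rightarrow> complex")

definition word :: "bword \<Rightarrow> fm" where
  "word w = Series (\<lambda>v. if v = w then 1 else 0)"

instantiation fm :: ring_1
begin

definition "0 = Series (\<lambda>_. 0)"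
definition "1 = word (Op Pm)"
definition "E + F = Series (\<lambda>w. coeff E w + coeff F w)"
definition "E - F = Series (\<lambda>w. coeff E w - coeff F w)"
definition "- E = Series (\<lambda>w. - coeff E w)"
definition "E * F = Series (\<lambda>w. \<Sum>(u, v)\<in>{(u, v). bword_mult u v = w}. coeff E u * coeff F v)"

instance
proof
  fix a c d :: fm
  show "a + c + d = a + (c + d)" "a + c = c + a" "0 + a = a" "- a + a = 0" "a - c = a + - c"
    by (simp_all add: plus_fm_def minus_fm_def uminus_fm_def zero_fm_def add_ac)
  show "(a + c) * d = a * d + c * d"
    by (simp add: plus_fm_def times_fm_def distrib_right sum.distrib split_def)
  show "a * (c + d) = a * c + a * d"
    by (simp add: plus_fm_def times_fm_def distrib_left sum.distrib split_def)
  show "(0::fm) \<noteq> 1"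
    by (auto simp: zero_fm_def one_fm_def word_def fun_eq_iff)
  have one_l: "(\<Sum>(u, v)\<in>{(u, v). bword_mult u v = w}. coeff 1 u * coeff a v) = coeff a w" for w
  proof -
    have "(\<Sum>(u, v)\<in>{(u, v). bword_mult u v = w}. coeff 1 u * coeff a v)
        = (\<Sum>(u, v)\<in>{(Op Pm, w)}. coeff 1 u * coeff a v)"
      by (rule sum.mono_neutral_right[OF finite_factorizations])
         (auto simp: one_fm_def word_def split: if_splits)
    then show ?thesis by (simp add: one_fm_def word_def)
  qed
  have one_r: "(\<Sum>(u, v)\<in>{(u, v). bword_mult u v = w}. coeff a u * coeff 1 v) = coeff a w" for w
  proof -
    have "(\<Sum>(u, v)\<in>{(u, v). bword_mult u v = w}. coeff a u * coeff 1 v)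
        = (\<Sum>(u, v)\<in>{(w, Op Pm)}. coeff a u * coeff 1 v)"
      by (rule sum.mono_neutral_right[OF finite_factorizations])
         (auto simp: one_fm_def word_def split: if_splits)
    then show ?thesis by (simp add: one_fm_def word_def)
  qed
  show "1 * a = a" "a * 1 = a"
    by (simp_all add: times_fm_def one_l one_r)
  show "a * c * d = a * (c * d)"
  proof (simp add: times_fm_def, rule ext)
    fix w
    let ?F = "\<lambda>w. {(u, v). bword_mult u v = w}"
    have "(\<Sum>(x, v)\<in>?F w. (\<Sum>(s, t)\<in>?F x. coeff a s * coeff c t) * coeff d v)
        = (\<Sum>xv\<in>?F w. \<Sum>st\<in>?F (fst xv). coeff a (fst st) * coeff c (snd st) * coeff d (snd xv))"
      by (simp add: split_def sum_distrib_right)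
    also have "\<dots> = (\<Sum>(xv, st)\<in>Sigma (?F w) (\<lambda>xv. ?F (fst xv)).
        coeff a (fst st) * coeff c (snd st) * coeff d (snd xv))"
      by (rule sum.Sigma) (auto simp: finite_factorizations)
    also have "\<dots> = (\<Sum>(xv, st)\<in>Sigma (?F w) (\<lambda>xv. ?F (snd xv)).
        coeff a (fst xv) * coeff c (fst st) * coeff d (snd st))"
      by (rule sum.reindex_bij_witness
          [where j = "\<lambda>(xv, st). ((fst st, bword_mult (snd st) (snd xv)), (snd st, snd xv))"
             and i = "\<lambda>(xv, st). ((bword_mult (fst xv) (fst st), snd st), (fst xv, fst st))"])
         (auto simp: bword_mult_assoc)
    also have "\<dots> = (\<Sum>xv\<in>?F w. \<Sum>st\<in>?F (snd xv).
        coeff a (fst xv) * coeff c (fst st) * coeff d (snd st))"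
      by (rule sum.Sigma[symmetric]) (auto simp: finite_factorizations)
    also have "\<dots> = (\<Sum>(u, x)\<in>?F w. coeff a u * (\<Sum>(s, t)\<in>?F x. coeff c s * coeff d t))"
      by (simp add: split_def sum_distrib_left mult.assoc)
    finally show "(\<Sum>(x, v)\<in>?F w. (\<Sum>(s, t)\<in>?F x. coeff a s * coeff c t) * coeff d v)
        = (\<Sum>(u, x)\<in>?F w. coeff a u * (\<Sum>(s, t)\<in>?F x. coeff c s * coeff d t))" .
  qed
qed

end

definition scaleF :: "complex \<Rightarrow> fm \<Rightarrow> fm"  (infixr \<open>*\<^sub>F\<close> 75) where
  "c *\<^sub>F E = Series (\<lambda>w. c * coeff E w)"

text \<open>
  Infinite sums are taken coefficientwise.  All sums below have only finitely many nonzero terms at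
  each word, because the orders of the summands in \<open>b\<close> tend to infinity.
\<close>

definition fm_sum :: "(nat \<Rightarrow> fm) \<Rightarrow> fm"  (binder \<open>\<Sigma>F \<close> 10) where
  "fm_sum E = Series (\<lambda>w. \<Sum>n. coeff (E n) w)"

text \<open>
  \<open>p\<close> is the unit of the ring, so that \<open>b\<close>, which in the calculus only occurs between factors
  \<open>p\<close> or \<open>k\<close>, is represented by the word \<open>p b p\<close>.
\<close>

abbreviation p :: fm where "p \<equiv> word (Op Pm)"
abbreviation k :: fm where "k \<equiv> word (Op Km)"
abbreviation b :: fm where "b \<equiv> word (OpB Pm (Op Pm))"

lemma p_eq_1: "p = 1"
  by (simp add: one_fm_def)

text \<open>The powers of \<open>p + \<pi>\<^sup>2 p b p b p\<close>, given by the binomial series.\<close>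

definition bb_powr :: "complex \<Rightarrow> fm" where
  "bb_powr a = (\<Sigma>F n. (a gchoose n) *\<^sub>F ((of_real pi)\<^sup>2 *\<^sub>F (p * b * p * b * p)) ^ n)"

definition A :: fm where
  "A = bb_powr (1/2) - p"

definition k_hat :: fm where
  "k_hat = (\<Sigma>F \<beta>. (- \<i> * of_real pi) ^ (2 * \<beta>) *\<^sub>F ((p + A) * k * (b * k) ^ (2 * \<beta>) * (p + A)))"

definition X :: fm where
  "X = - p + (\<Sigma>F \<beta>\<^sub>1. \<Sigma>F \<beta>\<^sub>2. (- \<i> * of_real pi) ^ (2 * (\<beta>\<^sub>1 + \<beta>\<^sub>2)) *\<^sub>F
     ((p + A) * k * (b * k) ^ (2 * \<beta>\<^sub>1) * (p + A)\<^sup>2 * k * (b * k) ^ (2 * \<beta>\<^sub>2) * (p + A)))"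

text \<open>\<open>dfact n\<close> is \<open>(2n - 3)!!\<close> for \<open>n \<ge> 1\<close>, the empty product giving \<open>(-1)!! = 1\<close>.\<close>

definition dfact :: "nat \<Rightarrow> nat" where
  "dfact n = (\<Prod>j=1..<n. 2 * j - 1)"

definition p_hat :: fm where
  "p_hat = p + (\<Sigma>F j. let n = Suc j in
     ((-1) ^ (n + 1) * of_nat (dfact n) / (fact n * 2 ^ n)) *\<^sub>F X ^ n)"

definition t_hat :: fm where
  "t_hat = (1/2) *\<^sub>F (p_hat - k_hat)"

definition Y_hat :: fm where
  "Y_hat = p + (\<Sigma>F j. let l = Suc j in (-1) ^ l *\<^sub>F X ^ l)"

text \<open>
  \<open>Enclosed E\<close> stands for \<open>b\<^sup>< E b\<^sup>>\<close>.  Products use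
  \<open>b\<^sup>> b\<^sup>< = p + \<pi>\<^sup>2 p b p b p\<close>.
\<close>

datatype dressed = Enclosed (body: fm)

instantiation dressed :: times
begin

definition "S * T = Enclosed (body S * (p + (of_real pi)\<^sup>2 *\<^sub>F (p * b * p * b * p)) * body T)"

instance ..

end

text \<open>\<open>breve E\<close> encloses \<open>E\<close> between \<open>b\<^sup><\<close> and \<open>b\<^sup>>\<close> with a breve on both.\<close>

definition breve :: "fm \<Rightarrow> dressed" where
  "breve E = Enclosed (bb_powr (-1/2) * E * bb_powr (-1/2))"

definition fermionic_projector :: dressed where
  "fermionic_projector = breve (t_hat * Y_hat * t_hat)"


section \<open>Operators on spinor fields\<close>

text \<open>
  The index type \<open>4\<close> has the elements 0, 1, 2, 3, with 0 the time index.  Vectors are given by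
  their contravariant components.
\<close>

type_synonym minkowski = "real^4"
type_synonym spinor = "complex^4"
type_synonym field = "minkowski \<Rightarrow> spinor"
type_synonym oper = "field \<Rightarrow> field"

definition eta :: "4 \<Rightarrow> 4 \<Rightarrow> real" where
  "eta \<mu> \<nu> = (if \<mu> \<noteq> \<nu> then 0 else if \<mu> = 0 then 1 else -1)"

definition minner :: "minkowski \<Rightarrow> minkowski \<Rightarrow> real" where
  "minner x y = (\<Sum>\<mu>\<in>UNIV. \<Sum>\<nu>\<in>UNIV. eta \<mu> \<nu> * x $ \<mu> * y $ \<nu>)"

definition dirac_matrices :: "(4 \<Rightarrow> complex^4^4) \<Rightarrow> bool" where
  "dirac_matrices \<gamma> \<longleftrightarrow>
     (\<forall>\<mu> \<nu>. \<gamma> \<mu> ** \<gamma> \<nu> + \<gamma> \<nu> ** \<gamma> \<mu> = mat (complex_of_real (2 * eta \<mu> \<nu>)))"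

fun pderivs :: "'a list \<Rightarrow> ('a::euclidean_space \<Rightarrow> 'c::real_normed_vector) \<Rightarrow> 'a \<Rightarrow> 'c" where
  "pderivs [] f = f"
| "pderivs (v # vs) f = pderivs vs (\<lambda>x. frechet_derivative f (at x) v)"

definition smooth :: "('a::euclidean_space \<Rightarrow> 'c::real_normed_vector) \<Rightarrow> bool" where
  "smooth f \<longleftrightarrow> (\<forall>vs x. set vs \<subseteq> Basis \<longrightarrow> pderivs vs f differentiable (at x))"

definition schwartz :: "('a::euclidean_space \<Rightarrow> 'c::real_normed_vector) \<Rightarrow> bool" where
  "schwartz f \<longleftrightarrow> smooth f \<and>
     (\<forall>vs n. set vs \<subseteq> Basis \<longrightarrow> bounded (range (\<lambda>x. norm x ^ n *\<^sub>R pderivs vs f x)))"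

definition mass_test_function :: "(real \<Rightarrow> complex) \<Rightarrow> bool" where
  "mass_test_function \<phi> \<longleftrightarrow> smooth \<phi> \<and>
     compact (closure {m. \<phi> m \<noteq> 0}) \<and> closure {m. \<phi> m \<noteq> 0} \<subseteq> {0<..}"

definition external_potential :: "(minkowski \<Rightarrow> complex^4^4) \<Rightarrow> bool" where
  "external_potential B \<longleftrightarrow> smooth B \<and> integrable lborel B \<and>
     (\<forall>i. integrable lborel (\<lambda>x. x $ i *\<^sub>R B x)) \<and>
     (\<forall>i j. integrable lborel (\<lambda>x. (x $ i * x $ j) *\<^sub>R B x))"

definition mult_op :: "(minkowski \<Rightarrow> complex^4^4) \<Rightarrow> oper" where
  "mult_op B f = (\<lambda>x. B x *v f x)"

subsection \<open>Free operators\<close>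

text \<open>
  An operator with kernel \<open>\<integral> d\<^sup>4q/(2\<pi>)\<^sup>4 G(q) e\<^sup>-\<^sup>i\<^sup>q\<^sup>(\<^sup>x\<^sup>-\<^sup>y\<^sup>)\<close> is applied to a field \<open>f\<close> by
  integrating over \<open>y\<close> first.  \<open>symb \<gamma> m f x q\<close> is what the remaining \<open>q\<close>-integral
  contains besides the scalar factor of \<open>G\<close>.
\<close>

definition fourier :: "field \<Rightarrow> field" where
  "fourier f q = (LINT y|lborel. exp (\<i> * of_real (minner q y)) *s f y)"

definition slash :: "(4 \<Rightarrow> complex^4^4) \<Rightarrow> minkowski \<Rightarrow> complex^4^4" where
  "slash \<gamma> q = (\<Sum>\<mu>\<in>UNIV. \<Sum>\<nu>\<in>UNIV. (eta \<mu> \<nu> * q $ \<nu>) *\<^sub>R \<gamma> \<mu>)"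

definition symb :: "(4 \<Rightarrow> complex^4^4) \<Rightarrow> real \<Rightarrow> field \<Rightarrow> minkowski \<Rightarrow> minkowski \<Rightarrow> spinor" where
  "symb \<gamma> m f x q = of_real (1 / (2 * pi) ^ 4) *s (exp (- \<i> * of_real (minner q x)) *s
     ((slash \<gamma> q + mat (of_real m)) *v fourier f q))"

text \<open>
  \<open>\<integral> d\<^sup>4q F(q) \<delta>(q\<^sup>2 - m\<^sup>2)\<close>, the \<open>q\<^sub>0\<close>-integral over the delta distribution being carried out:
  its zeros are \<open>q\<^sub>0 = \<plusminus>\<omega>\<close>, where the derivative of the argument has absolute value \<open>2\<omega>\<close>.
\<close>

definition four_vec :: "real \<Rightarrow> real^3 \<Rightarrow> minkowski" where
  "four_vec t v = (\<chi> \<mu>. if \<mu> = 0 then t else if \<mu> = 1 then v $ 1 else if \<mu> = 2 then v $ 2 else v $ 3)"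

definition shell_integral :: "real \<Rightarrow> (minkowski \<Rightarrow> spinor) \<Rightarrow> spinor" where
  "shell_integral m F = (LINT v|lborel. (let \<omega> = sqrt ((norm v)\<^sup>2 + m\<^sup>2) in
     (1 / (2 * \<omega>)) *\<^sub>R (F (four_vec \<omega> v) + F (four_vec (- \<omega>) v))))"

definition p_op :: "(4 \<Rightarrow> complex^4^4) \<Rightarrow> real \<Rightarrow> oper" where
  "p_op \<gamma> m f x = shell_integral m (symb \<gamma> m f x)"

definition k_op :: "(4 \<Rightarrow> complex^4^4) \<Rightarrow> real \<Rightarrow> oper" where
  "k_op \<gamma> m f x = shell_integral m (\<lambda>q. sgn (q $ 0) *\<^sub>R symb \<gamma> m f x q)"

definition s_adv :: "(4 \<Rightarrow> complex^4^4) \<Rightarrow> real \<Rightarrow> oper" where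
  "s_adv \<gamma> m f x = Lim (at_right 0) (\<lambda>\<epsilon>::real. LINT q|lborel.
     (1 / (of_real (minner q q) - of_real (m\<^sup>2) - \<i> * of_real (\<epsilon> * q $ 0))) *s symb \<gamma> m f x q)"

definition s_ret :: "(4 \<Rightarrow> complex^4^4) \<Rightarrow> real \<Rightarrow> oper" where
  "s_ret \<gamma> m f x = Lim (at_right 0) (\<lambda>\<epsilon>::real. LINT q|lborel.
     (1 / (of_real (minner q q) - of_real (m\<^sup>2) + \<i> * of_real (\<epsilon> * q $ 0))) *s symb \<gamma> m f x q)"

definition s_op :: "(4 \<Rightarrow> complex^4^4) \<Rightarrow> real \<Rightarrow> oper" where
  "s_op \<gamma> m f x = (1/2) *\<^sub>R (s_adv \<gamma> m f x + s_ret \<gamma> m f x)"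

subsection \<open>Formal power series in the potential\<close>

text \<open>A formal power series in \<open>B\<close> is given by its contributions of order \<open>0, 1, 2, \<dots>\<close>.\<close>

type_synonym oper_series = "nat \<Rightarrow> oper"

definition series_mult :: "oper_series \<Rightarrow> oper_series \<Rightarrow> oper_series"  (infixr \<open>\<odot>\<close> 70) where
  "(S \<odot> T) N f x = (\<Sum>i\<le>N. S i (T (N - i) f) x)"

definition b_less :: "(4 \<Rightarrow> complex^4^4) \<Rightarrow> (minkowski \<Rightarrow> complex^4^4) \<Rightarrow> real \<Rightarrow> oper_series" where
  "b_less \<gamma> B m n = (\<lambda>f x. - s_op \<gamma> m (mult_op B f) x) ^^ n"

definition b_greater :: "(4 \<Rightarrow> complex^4^4) \<Rightarrow> (minkowski \<Rightarrow> complex^4^4) \<Rightarrow> real \<Rightarrow> oper_series" where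
  "b_greater \<gamma> B m n = (\<lambda>f x. - mult_op B (s_op \<gamma> m f) x) ^^ n"

definition b_op :: "(4 \<Rightarrow> complex^4^4) \<Rightarrow> (minkowski \<Rightarrow> complex^4^4) \<Rightarrow> real \<Rightarrow> oper_series" where
  "b_op \<gamma> B m N = (case N of 0 \<Rightarrow> (\<lambda>f x. 0)
     | Suc n \<Rightarrow> ((\<lambda>f x. - mult_op B (s_op \<gamma> m f) x) ^^ n) \<circ> mult_op B)"

definition pk_op :: "(4 \<Rightarrow> complex^4^4) \<Rightarrow> real \<Rightarrow> pk \<Rightarrow> oper_series" where
  "pk_op \<gamma> m C N = (if N = 0 then (case C of Pm \<Rightarrow> p_op \<gamma> m | Km \<Rightarrow> k_op \<gamma> m) else (\<lambda>f x. 0))"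

fun word_op :: "(4 \<Rightarrow> complex^4^4) \<Rightarrow> (minkowski \<Rightarrow> complex^4^4) \<Rightarrow> real \<Rightarrow> bword \<Rightarrow> oper_series" where
  "word_op \<gamma> B m (Op C) = pk_op \<gamma> m C"
| "word_op \<gamma> B m (OpB C w) = pk_op \<gamma> m C \<odot> b_op \<gamma> B m \<odot> word_op \<gamma> B m w"

definition enclosed_word_op ::
  "(4 \<Rightarrow> complex^4^4) \<Rightarrow> (minkowski \<Rightarrow> complex^4^4) \<Rightarrow> real \<Rightarrow> bword \<Rightarrow> oper_series" where
  "enclosed_word_op \<gamma> B m w = b_less \<gamma> B m \<odot> word_op \<gamma> B m w \<odot> b_greater \<gamma> B m"

text \<open>
  The operator \<open>T\<^sub>m\<close> denoted by an expression \<open>T\<close> of the calculus.  Words with more than \<open>N\<close>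
  factors \<open>b\<close> do not contribute to the order \<open>N\<close>.
\<close>

definition dressed_op ::
  "(4 \<Rightarrow> complex^4^4) \<Rightarrow> (minkowski \<Rightarrow> complex^4^4) \<Rightarrow> dressed \<Rightarrow> real \<Rightarrow> oper_series" where
  "dressed_op \<gamma> B T m N f x =
     (\<Sum>w | num_b w \<le> N. coeff (body T) w *s enclosed_word_op \<gamma> B m w N f x)"

subsection \<open>Products of operators of different masses\<close>

text \<open>
  An operator product \<open>S\<^sub>m T\<^sub>m\<^sub>'\<close> is a distribution in the mass \<open>m'\<close>.  It is tested with \<open>\<phi>\<close>: the
  operators \<open>T\<^sub>m\<^sub>'\<close> are integrated against \<open>\<phi>\<close>, and \<open>S\<^sub>m\<close> is applied to the result.  Tested in
  this way, \<open>\<delta>(m - m') T\<^sub>m\<close> becomes \<open>\<phi>(m) T\<^sub>m\<close>.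
\<close>

definition word_mass_product ::
  "(4 \<Rightarrow> complex^4^4) \<Rightarrow> (minkowski \<Rightarrow> complex^4^4) \<Rightarrow> bword \<Rightarrow> bword \<Rightarrow> real \<Rightarrow>
     (real \<Rightarrow> complex) \<Rightarrow> oper_series" where
  "word_mass_product \<gamma> B v w m \<phi> N f x = (\<Sum>i\<le>N. enclosed_word_op \<gamma> B m v i
     (\<lambda>y. LINT m'|lborel. \<phi> m' *s enclosed_word_op \<gamma> B m' w (N - i) f y) x)"

text \<open>The products of linear combinations of words are formed termwise.\<close>

definition mass_product ::
  "(4 \<Rightarrow> complex^4^4) \<Rightarrow> (minkowski \<Rightarrow> complex^4^4) \<Rightarrow> dressed \<Rightarrow> dressed \<Rightarrow> real \<Rightarrow>
     (real \<Rightarrow> complex) \<Rightarrow> oper_series" where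
  "mass_product \<gamma> B S T m \<phi> N f x = (\<Sum>v | num_b v \<le> N. \<Sum>w | num_b w \<le> N.
     (coeff (body S) v * coeff (body T) w) *s word_mass_product \<gamma> B v w m \<phi> N f x)"

definition mass_delta ::
  "(4 \<Rightarrow> complex^4^4) \<Rightarrow> (minkowski \<Rightarrow> complex^4^4) \<Rightarrow> dressed \<Rightarrow> real \<Rightarrow>
     (real \<Rightarrow> complex) \<Rightarrow> oper_series" where
  "mass_delta \<gamma> B T m \<phi> N f x = \<phi> m *s dressed_op \<gamma> B T m N f x"

text \<open>
  The computation rules of the fixed-mass convention for the operators themselves.  At order zero
  they are the rules for \<open>p\<^sub>m p\<^sub>m\<^sub>'\<close>, \<open>k\<^sub>m k\<^sub>m\<^sub>'\<close>, \<open>p\<^sub>m k\<^sub>m\<^sub>'\<close>, \<open>k\<^sub>m p\<^sub>m\<^sub>'\<close>.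
\<close>

definition fixed_mass_convention ::
  "(4 \<Rightarrow> complex^4^4) \<Rightarrow> (minkowski \<Rightarrow> complex^4^4) \<Rightarrow> bool" where
  "fixed_mass_convention \<gamma> B \<longleftrightarrow> (\<forall>v w m \<phi> N f x. m > 0 \<longrightarrow> mass_test_function \<phi> \<longrightarrow> schwartz f \<longrightarrow>
     word_mass_product \<gamma> B v w m \<phi> N f x =
       mass_delta \<gamma> B (Enclosed (word v) * Enclosed (word w)) m \<phi> N f x)"

end

theory Submission
  imports Defs
begin

text \<open>
  The double series defining \<open>X\<close> factorizes, which gives \<open>k_hat\<^sup>2 = 1 + X\<close>.  Hence \<open>X\<close> commutes with
  \<open>k_hat\<close>, and so do \<open>p_hat = (1 + X)\<^sup>1\<^sup>/\<^sup>2\<close> and \<open>Y_hat = (1 + X)\<^sup>-\<^sup>1\<close>, being power series in \<open>X\<close>.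
  From \<open>k_hat\<^sup>2 = p_hat\<^sup>2\<close> one gets \<open>t_hat\<^sup>2 = p_hat t_hat\<close> and therefore
  \<open>(t_hat Y_hat t_hat)\<^sup>2 = t_hat\<^sup>4 Y_hat\<^sup>2 = p_hat\<^sup>2 t_hat\<^sup>2 Y_hat\<^sup>2 = t_hat\<^sup>2 Y_hat\<close>.  Substituting a series
  without term of order zero into formal power series is a homomorphism, so that the powers
  obey the exponent law of the binomial series.
\<close>

section \<open>Orders and infinite sums\<close>

lemma coeff_simps [simp]:
  "coeff 0 w = 0" "coeff (E + F) w = coeff E w + coeff F w"
  "coeff (E - F) w = coeff E w - coeff F w" "coeff (- E) w = - coeff E w"
  "coeff (c *\<^sub>F E) w = c * coeff E w"
  by (simp_all add: zero_fm_def plus_fm_def minus_fm_def uminus_fm_def scaleF_def)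

lemma fm_coeff_mult:
  "coeff (E * F) w = (\<Sum>(u, v)\<in>{(u, v). bword_mult u v = w}. coeff E u * coeff F v)"
  by (simp add: times_fm_def)

lemma fm_coeff_sum [simp]: "coeff (sum G I) w = (\<Sum>i\<in>I. coeff (G i) w)"
  by (induction I rule: infinite_finite_induct) auto

lemma coeff_word: "coeff (word v) w = (if w = v then 1 else 0)"
  by (simp add: word_def)

lemma fm_eqI: "(\<And>w. coeff E w = coeff F w) \<Longrightarrow> E = F"
  by (cases E; cases F) auto

lemma word_mult: "word v * word w = word (bword_mult v w)"
proof (rule fm_eqI)
  fix x
  have "coeff (word v * word w) x =
      (\<Sum>y\<in>{(u, u'). bword_mult u u' = x}. if y = (v, w) then 1 else 0)"
    unfolding fm_coeff_mult by (rule sum.cong) (auto simp: coeff_word split: if_splits)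
  also have "\<dots> = coeff (word (bword_mult v w)) x"
    using finite_factorizations[of x] by (auto simp: coeff_word)
  finally show "coeff (word v * word w) x = coeff (word (bword_mult v w)) x" .
qed

lemma scaleF_mult_left [simp]: "c *\<^sub>F E * F = c *\<^sub>F (E * F)"
  and scaleF_mult_right [simp]: "E * c *\<^sub>F F = c *\<^sub>F (E * F)"
  by (auto intro!: fm_eqI sum.cong simp: fm_coeff_mult sum_distrib_left)

lemma scaleF_scaleF [simp]: "c *\<^sub>F d *\<^sub>F E = (c * d) *\<^sub>F E"
  by (simp add: scaleF_def mult.assoc)

lemma scaleF_one [simp]: "1 *\<^sub>F E = E"
  by (auto intro: fm_eqI)

lemma scaleF_zero [simp]: "0 *\<^sub>F E = 0"
  by (auto intro: fm_eqI)

text \<open>The filtration by order in the potential. A family with \<open>ord_ge n (G n)\<close>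
  for all \<open>n\<close> is summable, since each word occurs in only finitely many
  members.\<close>

definition ord_ge :: "nat \<Rightarrow> fm \<Rightarrow> bool" where
  "ord_ge n E \<longleftrightarrow> (\<forall>w. num_b w < n \<longrightarrow> coeff E w = 0)"

lemma ord_ge_0 [simp]: "ord_ge 0 E"
  by (simp add: ord_ge_def)

lemma ord_ge_mono: "ord_ge n E \<Longrightarrow> m \<le> n \<Longrightarrow> ord_ge m E"
  by (simp add: ord_ge_def)

lemma ord_ge_add: "ord_ge n E \<Longrightarrow> ord_ge n F \<Longrightarrow> ord_ge n (E + F)"
  and ord_ge_scaleF: "ord_ge n E \<Longrightarrow> ord_ge n (c *\<^sub>F E)"
  by (simp_all add: ord_ge_def)

lemma ord_ge_mult:
  assumes "ord_ge m E" "ord_ge n F"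
  shows "ord_ge (m + n) (E * F)"
  unfolding ord_ge_def
proof (intro allI impI)
  fix w assume "num_b w < m + n"
  then have "coeff E u * coeff F v = 0" if "bword_mult u v = w" for u v
    using assms that num_b_mult[of u v] unfolding ord_ge_def
    by (cases "num_b u < m") auto
  then show "coeff (E * F) w = 0"
    unfolding fm_coeff_mult by (intro sum.neutral) auto
qed

lemma ord_ge_mult_left: "ord_ge n F \<Longrightarrow> ord_ge n (E * F)"
  and ord_ge_mult_right: "ord_ge n E \<Longrightarrow> ord_ge n (E * F)"
  using ord_ge_mult[of 0 E n F] ord_ge_mult[of n E 0 F] by simp_all

lemma ord_ge_power: "ord_ge (Suc 0) E \<Longrightarrow> ord_ge n (E ^ n)"
proof (induction n)
  case (Suc n)
  then show ?case using ord_ge_mult[of "Suc 0" E n "E ^ n"] by simp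
qed simp

lemma ord_ge_b: "ord_ge (Suc 0) b"
  by (simp add: ord_ge_def coeff_word)

text \<open>Terms beyond \<open>num_b w\<close> vanish at \<open>w\<close>, so \<open>suminf\<close>
  is a finite sum. The bound \<open>N\<close> is left free so that words of different orders can
  share one range.\<close>

lemma coeff_fm_sum:
  assumes "\<And>n. ord_ge n (G n)" "num_b w \<le> N"
  shows "coeff (fm_sum G) w = (\<Sum>n\<le>N. coeff (G n) w)"
  unfolding fm_sum_def fm.sel
  by (rule suminf_finite) (use assms in \<open>auto simp: ord_ge_def\<close>)

lemma ord_ge_fm_sum:
  assumes "\<And>n. ord_ge n (G n)" "\<And>n. ord_ge m (G n)"
  shows "ord_ge m (fm_sum G)"
  using assms(2) by (simp add: ord_ge_def coeff_fm_sum[OF assms(1) order_refl])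

text \<open>Both factors of \<open>w\<close> have at most \<open>num_b w\<close> letters
  \<open>b\<close>; truncating at this common bound reduces distributivity to exchanging finite
  sums.\<close>

lemma fm_sum_mult_left:
  assumes "\<And>n. ord_ge n (G n)"
  shows "H * fm_sum G = fm_sum (\<lambda>n. H * G n)"
proof (rule fm_eqI)
  fix w
  let ?F = "{(u, v). bword_mult u v = w}"
  have "coeff (H * fm_sum G) w = (\<Sum>(u, v)\<in>?F. coeff H u * (\<Sum>n\<le>num_b w. coeff (G n) v))"
    unfolding fm_coeff_mult
    by (intro sum.cong) (auto simp: num_b_mult coeff_fm_sum[OF assms])
  also have "\<dots> = (\<Sum>n\<le>num_b w. coeff (H * G n) w)"
    unfolding fm_coeff_mult split_def sum_distrib_left by (rule sum.swap)
  also have "\<dots> = coeff (fm_sum (\<lambda>n. H * G n)) w"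
    by (rule coeff_fm_sum[symmetric]) (simp_all add: ord_ge_mult_left assms)
  finally show "coeff (H * fm_sum G) w = coeff (fm_sum (\<lambda>n. H * G n)) w" .
qed

lemma fm_sum_mult_right:
  assumes "\<And>n. ord_ge n (G n)"
  shows "fm_sum G * H = fm_sum (\<lambda>n. G n * H)"
proof (rule fm_eqI)
  fix w
  let ?F = "{(u, v). bword_mult u v = w}"
  have "coeff (fm_sum G * H) w = (\<Sum>(u, v)\<in>?F. (\<Sum>n\<le>num_b w. coeff (G n) u) * coeff H v)"
    unfolding fm_coeff_mult
    by (intro sum.cong) (auto simp: num_b_mult coeff_fm_sum[OF assms])
  also have "\<dots> = (\<Sum>n\<le>num_b w. coeff (G n * H) w)"
    unfolding fm_coeff_mult split_def sum_distrib_right by (rule sum.swap)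
  also have "\<dots> = coeff (fm_sum (\<lambda>n. G n * H)) w"
    by (rule coeff_fm_sum[symmetric]) (simp_all add: ord_ge_mult_right assms)
  finally show "coeff (fm_sum G * H) w = coeff (fm_sum (\<lambda>n. G n * H)) w" .
qed

lemma fm_sum_split_head:
  assumes "\<And>n. ord_ge n (G n)"
  shows "fm_sum G = G 0 + fm_sum (\<lambda>n. G (Suc n))"
proof (rule fm_eqI)
  fix w
  have "ord_ge n (G (Suc n))" for n
    using ord_ge_mono[OF assms[of "Suc n"]] by simp
  then have "coeff (fm_sum (\<lambda>n. G (Suc n))) w = (\<Sum>n\<le>num_b w. coeff (G (Suc n)) w)"
    by (rule coeff_fm_sum) simp
  moreover have "coeff (fm_sum G) w = (\<Sum>n\<le>Suc (num_b w). coeff (G n) w)"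
    by (rule coeff_fm_sum[OF assms]) simp
  ultimately show "coeff (fm_sum G) w = coeff (G 0 + fm_sum (\<lambda>n. G (Suc n))) w"
    by (simp only: sum.atMost_Suc_shift coeff_simps)
qed

lemma fm_sum_zero [simp]: "fm_sum (\<lambda>n. 0) = 0"
  by (rule fm_eqI) (simp add: fm_sum_def)

section \<open>Substitution into formal power series\<close>

text \<open>The series \<open>f\<close> evaluated at \<open>Z\<close>. Going through the type of
  formal power series makes its laws for binomial series available in \<open>fm\<close>.\<close>

definition fps_subst :: "fm \<Rightarrow> complex fps \<Rightarrow> fm" where
  "fps_subst Z f = (\<Sigma>F n. fps_nth f n *\<^sub>F Z ^ n)"

lemma ord_ge_fps_term: "ord_ge (Suc 0) Z \<Longrightarrow> ord_ge n (c *\<^sub>F Z ^ n)"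
  by (intro ord_ge_scaleF ord_ge_power)

lemma fps_subst_split_head:
  assumes "ord_ge (Suc 0) Z"
  shows "fps_subst Z f = fps_nth f 0 *\<^sub>F 1 + (\<Sigma>F n. fps_nth f (Suc n) *\<^sub>F Z ^ Suc n)"
  unfolding fps_subst_def fm_sum_split_head[OF ord_ge_fps_term[OF assms]] by simp

lemma fps_subst_one_plus_X:
  assumes "ord_ge (Suc 0) Z"
  shows "fps_subst Z (1 + fps_X) = 1 + Z"
proof -
  have *: "ord_ge n (fps_nth (1 + fps_X) (Suc n) *\<^sub>F Z ^ Suc n)" for n
    using ord_ge_fps_term[OF assms, of "Suc n"] by (rule ord_ge_mono) simp
  show ?thesis
    by (simp only: fps_subst_split_head[OF assms] fm_sum_split_head[OF *]) simp
qed

lemma fps_subst_one: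
  assumes "ord_ge (Suc 0) Z"
  shows "fps_subst Z 1 = 1"
  by (simp only: fps_subst_split_head[OF assms]) simp

text \<open>At a fixed word both sides are finite sums of terms with \<open>Z ^ (i + j)\<close>;
  grouping by \<open>n = i + j\<close> produces the Cauchy product.\<close>

lemma fps_subst_mult:
  assumes "ord_ge (Suc 0) Z"
  shows "fps_subst Z f * fps_subst Z g = fps_subst Z (f * g)"
proof (rule fm_eqI)
  fix w
  let ?c = "\<lambda>i j. fps_nth f i * fps_nth g j * coeff (Z ^ (i + j)) w"
  let ?N = "num_b w"
  note Z = ord_ge_fps_term[OF assms]
  have nonzero: "i + j \<le> ?N" if "coeff (Z ^ (i + j)) w \<noteq> 0" for i j
    using ord_ge_power[OF assms, of "i + j"] that unfolding ord_ge_def by (meson not_le)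
  have "fps_subst Z f * fps_subst Z g = (\<Sigma>F i. fps_nth f i *\<^sub>F Z ^ i * fps_subst Z g)"
    unfolding fps_subst_def[of Z f] by (rule fm_sum_mult_right[OF Z])
  also have "\<dots> = (\<Sigma>F i. \<Sigma>F j. (fps_nth f i * fps_nth g j) *\<^sub>F Z ^ (i + j))"
    unfolding fps_subst_def fm_sum_mult_left[OF Z]
    by (simp add: power_add mult.commute[where 'a = complex])
  finally have "fps_subst Z f * fps_subst Z g =
      (\<Sigma>F i. \<Sigma>F j. (fps_nth f i * fps_nth g j) *\<^sub>F Z ^ (i + j))" .
  moreover have ord2: "ord_ge j ((fps_nth f i * fps_nth g j) *\<^sub>F Z ^ (i + j))" for i j
    using ord_ge_mono[OF Z[of "i + j"]] by simp
  moreover have "ord_ge i (\<Sigma>F j. (fps_nth f i * fps_nth g j) *\<^sub>F Z ^ (i + j))" for i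
    by (intro ord_ge_fm_sum ord2 ord_ge_mono[OF Z[of "i + _"]]) simp
  ultimately have "coeff (fps_subst Z f * fps_subst Z g) w = (\<Sum>i\<le>?N. \<Sum>j\<le>?N. ?c i j)"
    by (simp add: coeff_fm_sum[where w = w and N = ?N])
  also have "\<dots> = (\<Sum>(i, j)\<in>{..?N} \<times> {..?N}. ?c i j)"
    by (rule sum.cartesian_product)
  \<comment> \<open>Off the triangle, \<open>i + j\<close> exceeds \<open>num_b w\<close>, so
    \<open>Z ^ (i + j)\<close> vanishes at \<open>w\<close>.\<close>
  also have "\<dots> = (\<Sum>(i, j)\<in>{(i, j). i + j \<le> ?N}. ?c i j)"
    by (rule sum.mono_neutral_right) (auto dest: nonzero)
  also have "\<dots> = (\<Sum>n\<le>?N. \<Sum>i\<le>n. ?c i (n - i))"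
    by (rule sum.triangle_reindex_eq)
  also have "\<dots> = coeff (fps_subst Z (f * g)) w"
    unfolding fps_subst_def coeff_fm_sum[OF Z order_refl]
    by (simp add: fps_mult_nth sum_distrib_right atMost_atLeast0)
  finally show "coeff (fps_subst Z f * fps_subst Z g) w = coeff (fps_subst Z (f * g)) w" .
qed

lemma fps_subst_commute:
  assumes "ord_ge (Suc 0) Z" "H * Z = Z * H"
  shows "H * fps_subst Z f = fps_subst Z f * H"
proof -
  note Z = ord_ge_fps_term[OF assms(1)]
  have "H * Z ^ n = Z ^ n * H" for n
    using power_commuting_commutes[of Z H n] assms(2) by simp
  then show ?thesis
    unfolding fps_subst_def fm_sum_mult_right[OF Z] fm_sum_mult_left[OF Z] by simp
qed

section \<open>The factors of the fermionic projector\<close>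

definition bb :: fm where
  "bb = (of_real pi)\<^sup>2 *\<^sub>F (p * b * p * b * p)"

lemma ord_ge_bb: "ord_ge (Suc 0) bb"
  unfolding bb_def
  by (intro ord_ge_scaleF ord_ge_mult_right[of _ _ p] ord_ge_mult_left[of _ b] ord_ge_b)

lemma bb_powr_eq: "bb_powr a = fps_subst bb (fps_binomial a)"
  by (simp add: bb_powr_def fps_subst_def bb_def)

lemma bb_powr_add: "bb_powr a * bb_powr c = bb_powr (a + c)"
  by (simp add: bb_powr_eq fps_subst_mult ord_ge_bb fps_binomial_add_mult)

lemma bb_powr_0: "bb_powr 0 = 1"
  by (simp add: bb_powr_eq fps_subst_one ord_ge_bb)

lemma bb_powr_1: "bb_powr 1 = p + bb"
  by (simp add: bb_powr_eq fps_subst_one_plus_X ord_ge_bb fps_binomial_1 p_eq_1)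

text \<open>The two inner powers and the factor \<open>p + bb\<close> between them combine to the
  exponent -1/2 + 1 - 1/2 = 0.\<close>

lemma breve_mult: "breve E * breve F = breve (E * F)"
proof -
  \<comment> \<open>The factor \<open>G\<close> makes the cancellation usable inside
    right-associated products.\<close>
  have "bb_powr (-1/2) * ((p + bb) * (bb_powr (-1/2) * G)) = G" for G
    by (simp add: bb_powr_1[symmetric] mult.assoc[symmetric] bb_powr_add bb_powr_0)
  then show ?thesis
    unfolding breve_def times_dressed_def bb_def[symmetric] by (simp add: mult.assoc)
qed

section \<open>The square of \<open>k_hat\<close> and the order of \<open>X\<close>\<close>

lemma k_mult_k: "k * k = 1"
  by (simp add: word_mult pk_mult_def one_fm_def)

lemma ord_ge_A: "ord_ge (Suc 0) A"
proof -
  have "A = (\<Sigma>F n. fps_nth (fps_binomial (1/2)) (Suc n) *\<^sub>F bb ^ Suc n)"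
    by (simp only: A_def bb_powr_eq fps_subst_split_head[OF ord_ge_bb]) (simp add: p_eq_1)
  moreover have "ord_ge (Suc 0) \<dots>"
    by (intro ord_ge_fm_sum ord_ge_mono[OF ord_ge_fps_term[OF ord_ge_bb]]) simp_all
  ultimately show ?thesis by simp
qed

definition k_term :: "nat \<Rightarrow> fm" where
  "k_term \<beta> = (- \<i> * of_real pi) ^ (2 * \<beta>) *\<^sub>F ((p + A) * k * (b * k) ^ (2 * \<beta>) * (p + A))"

lemma k_hat_eq: "k_hat = fm_sum k_term"
  by (simp add: k_hat_def k_term_def[abs_def])

lemma ord_ge_k_term: "ord_ge (2 * \<beta>) (k_term \<beta>)"
  unfolding k_term_def
  by (intro ord_ge_scaleF ord_ge_mult_right[of _ _ "p + A"] ord_ge_mult_left[of _ "_ ^ _"]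
      ord_ge_power ord_ge_mult_right[of _ b] ord_ge_b)

lemma ord_ge_k_term': "ord_ge \<beta> (k_term \<beta>)"
  by (rule ord_ge_mono[OF ord_ge_k_term]) simp

lemma k_hat_square: "k_hat * k_hat = 1 + X"
proof -
  have "k_hat * k_hat = (\<Sigma>F \<beta>\<^sub>1. k_term \<beta>\<^sub>1 * k_hat)"
    unfolding k_hat_eq by (rule fm_sum_mult_right[OF ord_ge_k_term'])
  also have "\<dots> = (\<Sigma>F \<beta>\<^sub>1. \<Sigma>F \<beta>\<^sub>2. k_term \<beta>\<^sub>1 * k_term \<beta>\<^sub>2)"
    unfolding k_hat_eq fm_sum_mult_left[OF ord_ge_k_term'] ..
  \<comment> \<open>Adjacent factors \<open>p + A\<close> of the two terms merge into the square in
    the middle of the series for \<open>X\<close>.\<close>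
  also have "\<dots> = p + X"
    by (simp add: X_def k_term_def power_add power2_eq_square mult.assoc add_mult_distrib2
        mult.commute[where 'a = complex])
  finally show ?thesis by (simp add: p_eq_1)
qed

lemma ord_ge_k_hat_diff: "ord_ge (Suc 0) (k_hat - k)"
proof -
  \<comment> \<open>At order zero only the term with index 0 is left.\<close>
  have "ord_ge (Suc 0) (k_hat - k_term 0)"
    unfolding ord_ge_def
    by (auto simp: k_hat_eq coeff_fm_sum[OF ord_ge_k_term' order_refl])
  moreover have "k_term 0 - k = A * k + (k * A + A * (k * A))"
    by (simp add: k_term_def p_eq_1 algebra_simps)
  then have "ord_ge (Suc 0) (k_term 0 - k)"
    by (simp add: ord_ge_add ord_ge_mult_left ord_ge_mult_right ord_ge_A)
  ultimately have "ord_ge (Suc 0) (k_hat - k_term 0 + (k_term 0 - k))"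
    by (rule ord_ge_add)
  then show ?thesis by simp
qed

text \<open>As \<open>k * k = 1\<close>, \<open>X\<close> is the difference of the squares of
  \<open>k_hat\<close> and \<open>k\<close>, and each summand of its telescoped form contains
  \<open>k_hat - k\<close>. Positive order is what allows substituting \<open>X\<close> into power
  series.\<close>

lemma ord_ge_X: "ord_ge (Suc 0) X"
proof -
  have X: "X = (k_hat - k) * k_hat + k * (k_hat - k)"
    by (simp add: algebra_simps k_hat_square k_mult_k)
  show ?thesis
    by (subst X) (simp add: ord_ge_add ord_ge_mult_left ord_ge_mult_right ord_ge_k_hat_diff)
qed

lemma X_commutes_k_hat: "k_hat * X = X * k_hat"
proof -
  have X: "X = k_hat * k_hat - 1" by (simp add: k_hat_square)
  show ?thesis unfolding X by (simp add: right_diff_distrib left_diff_distrib mult.assoc)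
qed

section \<open>Binomial series in \<open>X\<close>\<close>

lemma gbinomial_half:
  "(1/2 :: complex) gchoose Suc j =
     (-1) ^ (Suc j + 1) * of_nat (dfact (Suc j)) / (fact (Suc j) * 2 ^ Suc j)"
proof (induction j)
  case 0
  show ?case by (simp add: dfact_def)
next
  case (Suc j)
  have d: "dfact (Suc (Suc j)) = dfact (Suc j) * (2 * j + 1)"
    by (simp add: dfact_def)
  \<comment> \<open>With \<open>n = Suc j\<close>, passing from \<open>n\<close> to
    \<open>n + 1\<close> multiplies both sides of the claim by (1/2 - n)/(n + 1).\<close>
  have "(1/2 :: complex) gchoose Suc (Suc j) =
      ((1/2) gchoose Suc j) * (1/2 - of_nat (Suc j)) / of_nat (Suc (Suc j))"
    using gbinomial_mult_1[of "1/2 :: complex" "Suc j"]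
    by (simp add: eq_divide_eq algebra_simps del: of_nat_Suc)
  then show ?case unfolding Suc.IH d by (simp add: field_simps)
qed

text \<open>Upper negation leaves \<open>n\<close> choose \<open>n\<close> up to sign. This makes
  the alternating series of \<open>Y_hat\<close> the binomial series with exponent -1.\<close>

lemma gbinomial_minus_one: "(-1 :: complex) gchoose n = (-1) ^ n"
  by (subst gbinomial_negated_upper) (simp flip: binomial_gbinomial)

lemma p_hat_eq: "p_hat = fps_subst X (fps_binomial (1/2))"
  by (simp add: p_hat_def fps_subst_split_head[OF ord_ge_X] p_eq_1 Let_def gbinomial_half
      del: power_Suc fact_Suc)

lemma Y_hat_eq: "Y_hat = fps_subst X (fps_binomial (-1))"
  by (simp add: Y_hat_def fps_subst_split_head[OF ord_ge_X] p_eq_1 Let_def gbinomial_minus_one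
      del: power_Suc)

lemma p_hat_square: "p_hat * p_hat = 1 + X"
  by (simp add: p_hat_eq fps_subst_mult ord_ge_X fps_subst_one_plus_X fps_binomial_1
      flip: fps_binomial_add_mult)

lemma Y_hat_inverse: "(1 + X) * Y_hat = 1"
  by (simp add: Y_hat_eq fps_subst_mult ord_ge_X fps_subst_one
      flip: fps_subst_one_plus_X fps_binomial_1 fps_binomial_add_mult)

section \<open>Algebra of \<open>t_hat\<close> and idempotence\<close>

lemma t_hat_square: "t_hat * t_hat = p_hat * t_hat"
proof -
  have "k_hat * p_hat = p_hat * k_hat"
    unfolding p_hat_eq by (intro fps_subst_commute ord_ge_X X_commutes_k_hat)
  \<comment> \<open>As the squares agree, the left side is twice
    \<open>p_hat * (p_hat - k_hat)\<close>; the 2, written as a sum, absorbs one factor 1/2 of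
    \<open>t_hat * t_hat\<close>.\<close>
  then have "(p_hat - k_hat) * (p_hat - k_hat) =
      p_hat * (p_hat - k_hat) + p_hat * (p_hat - k_hat)"
    by (simp add: algebra_simps p_hat_square k_hat_square)
  then show ?thesis by (intro fm_eqI) (simp add: t_hat_def)
qed

lemma hat_projector_idem: "t_hat * Y_hat * t_hat * (t_hat * Y_hat * t_hat) = t_hat * Y_hat * t_hat"
proof -
  have pX: "p_hat * X = X * p_hat"
    using fps_subst_commute[OF ord_ge_X refl] by (simp add: p_hat_eq)
  have pY: "p_hat * Y_hat = Y_hat * p_hat" and kY: "k_hat * Y_hat = Y_hat * k_hat"
    unfolding Y_hat_eq by (intro fps_subst_commute ord_ge_X pX X_commutes_k_hat)+
  have tY: "t_hat * Y_hat = Y_hat * t_hat"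
    by (simp add: t_hat_def algebra_simps pY kY)
  have tt: "t_hat * t_hat * (t_hat * t_hat) = (1 + X) * (t_hat * t_hat)"
    by (metis mult.assoc p_hat_square t_hat_square)
  have "t_hat * Y_hat * t_hat * (t_hat * Y_hat * t_hat) =
      Y_hat * Y_hat * (t_hat * t_hat * (t_hat * t_hat))"
    by (metis mult.assoc tY)
  also have "\<dots> = Y_hat * (Y_hat * (1 + X)) * (t_hat * t_hat)"
    unfolding tt by (simp only: mult.assoc)
  also have "Y_hat * (1 + X) = 1"
    by (metis Y_hat_inverse mult.assoc p_hat_square pY)
  finally show ?thesis by (simp add: tY mult.assoc)
qed

section \<open>Products in the fixed-mass convention\<close>

text \<open>Truncating \<open>E\<close> and \<open>F\<close> at order \<open>N\<close> changes the
  product only above order \<open>N\<close>. This turns a product of infinite combinations into the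
  finite double sum used in \<open>mass_product\<close>.\<close>

lemma coeff_mult_truncated:
  assumes "num_b x \<le> N"
  shows "coeff (E * M * F) x = (\<Sum>v | num_b v \<le> N. \<Sum>w | num_b w \<le> N.
    coeff E v * coeff F w * coeff (word v * M * word w) x)"
proof -
  have trunc: "ord_ge (Suc N) (G - (\<Sum>u | num_b u \<le> N. coeff G u *\<^sub>F word u))" for G
    using finite_num_b[of N]
    by (auto simp: ord_ge_def coeff_word less_Suc_eq_le if_distrib cong: if_cong)
  let ?E = "\<Sum>u | num_b u \<le> N. coeff E u *\<^sub>F word u"
  let ?F = "\<Sum>u | num_b u \<le> N. coeff F u *\<^sub>F word u"
  have "E * M * F - ?E * M * ?F = (E - ?E) * (M * F) + ?E * M * (F - ?F)"
    by (simp add: algebra_simps)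
  also have "ord_ge (Suc N) \<dots>"
    by (intro ord_ge_add ord_ge_mult_left[OF trunc] ord_ge_mult_right[OF trunc])
  finally have "coeff (E * M * F) x = coeff (?E * M * ?F) x"
    using assms by (simp add: ord_ge_def)
  also have "\<dots> = (\<Sum>v | num_b v \<le> N. \<Sum>w | num_b w \<le> N.
      coeff E v * coeff F w * coeff (word v * M * word w) x)"
    unfolding sum_distrib_right unfolding sum_distrib_left by (simp add: mult.assoc mult.left_commute)
  finally show ?thesis .
qed

text \<open>The convention covers pairs of words; expanding \<open>S\<close> and \<open>T\<close> up
  to order \<open>N\<close> extends it by bilinearity.\<close>

lemma mass_product_eq_mass_delta:
  assumes "fixed_mass_convention \<gamma> B" "m > 0" "mass_test_function \<phi>" "schwartz f"
  shows "mass_product \<gamma> B S T m \<phi> N f x = mass_delta \<gamma> B (S * T) m \<phi> N f x"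
proof -
  let ?W = "{w. num_b w \<le> N}"
  let ?M = "p + (of_real pi)\<^sup>2 *\<^sub>F (p * b * p * b * p)"
  let ?e = "\<lambda>u. enclosed_word_op \<gamma> B m u N f x"
  have "word_mass_product \<gamma> B v w m \<phi> N f x =
      \<phi> m *s (\<Sum>u\<in>?W. coeff (word v * ?M * word w) u *s ?e u)" for v w
    using assms by (simp add: fixed_mass_convention_def mass_delta_def dressed_op_def times_dressed_def)
  then have "mass_product \<gamma> B S T m \<phi> N f x = (\<Sum>v\<in>?W. \<Sum>w\<in>?W. \<Sum>u\<in>?W.
      (\<phi> m * (coeff (body S) v * coeff (body T) w * coeff (word v * ?M * word w) u)) *s ?e u)"
    by (simp only: mass_product_def vec.scale_sum_right vector_smult_assoc mult.assoc
        mult.left_commute[of _ "\<phi> m"])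
  \<comment> \<open>The sum over \<open>u\<close> moves outside those over \<open>v\<close> and
    \<open>w\<close>, so that the inner sums form the coefficient of \<open>S * T\<close> at
    \<open>u\<close>.\<close>
  also have "\<dots> = (\<Sum>u\<in>?W. \<Sum>v\<in>?W. \<Sum>w\<in>?W.
      (\<phi> m * (coeff (body S) v * coeff (body T) w * coeff (word v * ?M * word w) u)) *s ?e u)"
    by (rule trans[OF sum.cong[OF refl sum.swap] sum.swap])
  also have "\<dots> = (\<Sum>u\<in>?W. (\<phi> m * coeff (body (S * T)) u) *s ?e u)"
    by (rule sum.cong)
       (simp_all only: times_dressed_def dressed.sel mem_Collect_eq
         coeff_mult_truncated[of _ N "body S" _ "body T"] sum_distrib_left vec.scale_sum_left)
  also have "\<dots> = mass_delta \<gamma> B (S * T) m \<phi> N f x"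
    by (simp only: mass_delta_def dressed_op_def vec.scale_sum_right vector_smult_assoc)
  finally show ?thesis .
qed

theorem proposition3p2:
  fixes \<gamma> :: "4 \<Rightarrow> complex^4^4" and B :: "minkowski \<Rightarrow> complex^4^4"
  assumes "dirac_matrices \<gamma>" and "external_potential B"
  shows "fermionic_projector * fermionic_projector = fermionic_projector \<and>
    (fixed_mass_convention \<gamma> B \<longrightarrow>
      (\<forall>m \<phi> N f x. m > 0 \<longrightarrow> mass_test_function \<phi> \<longrightarrow> schwartz f \<longrightarrow>
        mass_product \<gamma> B fermionic_projector fermionic_projector m \<phi> N f x =
          mass_delta \<gamma> B fermionic_projector m \<phi> N f x))"
proof -
  have "fermionic_projector * fermionic_projector = fermionic_projector"
    by (simp add: fermionic_projector_def breve_mult hat_projector_idem)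
  then show ?thesis by (simp add: mass_product_eq_mass_delta)
qed

end
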